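(* Let $H$ be a nonzero complex Hilbert space, let $\mathbf{B}\ne\{0\}$ be a Banach space with respect to an $L(H)$-valued norm $F:\mathbf{B}\to L(H)$, and let $a\in\mathbf{B}\setminus\{0\}$. Let $\mathbf{B}^*_{L(H)}$ be the $L(H)$-dual space of $\mathbf{B}$ and let $M_a^\perp=\{\phi\in\mathbf{B}^*_{L(H)}:\phi(a)=0\}$. Then the quotient space $\mathbf{B}^*_{L(H)}/M_a^\perp$ is a Banach space with respect to the $L(H)$-valued norm $F_a:\mathbf{B}^*_{L(H)}/M_a^\perp\to L(H)$ defined by $$F_a(\varphi)=\|\varphi(a)\|\,F(a),$$ where $\varphi(a)$ is computed using any representative of the class $\varphi$.
   Context: $L(H)$ denotes the bounded linear operators on $H$ with the operator norm, and $S\le T$ means that $T-S$ is a positive operator, where an operator $P$ is positive if $(Ph,h)\ge 0$ for all $h\in H$. $I_H$ is the identity operator on $H$. An $L(H)$-valued norm on a complex linear space $X$ is a function $F:X\to L(H)$ such that (1) $F(x)\ge 0$ for all $x$; (2) $F(x+y)\le F(x)+F(y)$ for all $x,y$; (3) $F(\lambda x)=|\lambda|F(x)$ for all $\lambda\in\mathbb{C}$, $x\in X$; (4) $F(x)=0$ if and only if $x=0$. A sequence $\{x_n\}$ in $X$ is Cauchy with respect to $F$ if for every $\epsilon>0$ there is $N(\epsilon)$ with $F(x_n-x_m)\le\epsilon I_H$ for all $n,m\ge N(\epsilon)$; it converges to $x\in X$ with respect to $F$ if for every $\epsilon>0$ there is $N(\epsilon)$ with $F(x_n-x)\le\epsilon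 I_H$ for all $n\ge N(\epsilon)$. $X$ is complete with respect to $F$ if every sequence that is Cauchy with respect to $F$ converges with respect to $F$ to an element of $X$. A Banach space with respect to $F$ is a complex linear space $X$ with an $L(H)$-valued norm $F:X\to L(H)$ such that $X$ is complete with respect to $F$. For a Banach space $X$ with respect to $F:X\to L(H)$, the $L(H)$-dual space is $$X^*_{L(H)}=\Big\{g:X\to L(H)\ :\ g \text{ is linear and } \|g\|_F=\sup_{x\in X\setminus\{0\}}\frac{\|g(x)\|}{\|F(x)\|}<\infty\Big\}.$$ *)

theory Defs
  imports "HOL-Analysis.Analysis" "HOL-Algebra.Module" "HOL-Algebra.AbelCoset"
    "HOL-Algebra.Algebraic_Closure_Type"
begin

section \<open>Complex Hilbert spaces and \<open>L(H)\<close>\<close>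

text \<open>
  A complex Hilbert space is a real Banach space whose real scalar multiplication and norm are the
  ones derived from a complex scalar multiplication and a complex inner product (linear in the
  first argument). This makes the operator norm on \<^type>\<open>blinfun\<close> available for \<open>L(H)\<close>.
\<close>

class complex_inner = real_normed_vector +
  fixes scaleC :: "complex \<Rightarrow> 'a \<Rightarrow> 'a"  (infixr \<open>*\<^sub>C\<close> 75)
    and cinner :: "'a \<Rightarrow> 'a \<Rightarrow> complex"
  assumes scaleC_add_right: "c *\<^sub>C (x + y) = c *\<^sub>C x + c *\<^sub>C y"
    and scaleC_add_left: "(c + d) *\<^sub>C x = c *\<^sub>C x + d *\<^sub>C x"
    and scaleC_scaleC: "c *\<^sub>C (d *\<^sub>C x) = (c * d) *\<^sub>C x"
    and scaleC_one: "1 *\<^sub>C x = x"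
    and scaleR_scaleC: "r *\<^sub>R x = complex_of_real r *\<^sub>C x"
    and cinner_commute: "cinner x y = cnj (cinner y x)"
    and cinner_add_left: "cinner (x + y) z = cinner x z + cinner y z"
    and cinner_scaleC_left: "cinner (c *\<^sub>C x) y = c * cinner x y"
    and cinner_nonneg: "cinner x x \<in> \<real>\<^sub>\<ge>\<^sub>0"
    and cinner_eq_zero_iff: "cinner x x = 0 \<longleftrightarrow> x = 0"
    and norm_eq_sqrt_cinner: "norm x = sqrt (cmod (cinner x x))"

class complex_hilbert = complex_inner + banach

lemma norm_scaleC: "norm (c *\<^sub>C x) = cmod c * norm (x :: 'a :: complex_inner)"
proof -
  have "cinner (c *\<^sub>C x) (c *\<^sub>C x) = c * cnj c * cinner x x"
    by (metis cinner_commute cinner_scaleC_left complex_cnj_mult mult.assoc complex_cnj_cnj)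
  then show ?thesis
    by (simp add: norm_eq_sqrt_cinner norm_mult real_sqrt_mult)
qed

lemma bounded_linear_scaleC: "bounded_linear (\<lambda>x :: 'a :: complex_inner. c *\<^sub>C x)"
  by (rule bounded_linear_intro[where K = "cmod c"])
    (simp_all add: scaleC_add_right scaleR_scaleC scaleC_scaleC norm_scaleC mult.commute)

definition bounded_operators :: "('h :: complex_hilbert \<Rightarrow>\<^sub>L 'h) set"
  where "bounded_operators =
    {T. \<forall>c h. blinfun_apply T (c *\<^sub>C h) = c *\<^sub>C blinfun_apply T h}"

lift_definition scale_operator ::
    "complex \<Rightarrow> ('h :: complex_hilbert \<Rightarrow>\<^sub>L 'h) \<Rightarrow> ('h \<Rightarrow>\<^sub>L 'h)"
  is "\<lambda>c T h. c *\<^sub>C T h"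
  by (rule bounded_linear_compose[OF bounded_linear_scaleC])

definition positive_operator :: "('h :: complex_hilbert \<Rightarrow>\<^sub>L 'h) \<Rightarrow> bool"
  where "positive_operator P \<longleftrightarrow>
    P \<in> bounded_operators \<and> (\<forall>h. cinner (blinfun_apply P h) h \<in> \<real>\<^sub>\<ge>\<^sub>0)"

definition operator_le :: "('h :: complex_hilbert \<Rightarrow>\<^sub>L 'h) \<Rightarrow> ('h \<Rightarrow>\<^sub>L 'h) \<Rightarrow> bool"
    (infix \<open>\<le>\<^sub>L\<close> 50)
  where "S \<le>\<^sub>L T \<longleftrightarrow> positive_operator (T - S)"


section \<open>Banach spaces with respect to an \<open>L(H)\<close>-valued norm\<close>

text \<open>
  Complex linear spaces are modules over the field of complex numbers. The name is
  qualified to tell it from the type-based locale \<^locale>\<open>Modules.module\<close>.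
\<close>

abbreviation complex_ring :: "complex ring"
  where "complex_ring \<equiv> ring_of_type_algebra"

definition complex_linear_space :: "(complex, 'x, 'm) module_scheme \<Rightarrow> bool"
  where "complex_linear_space V \<longleftrightarrow> Module.module complex_ring V"

definition operator_valued_norm ::
    "(complex, 'x, 'm) module_scheme \<Rightarrow> ('x \<Rightarrow> ('h :: complex_hilbert \<Rightarrow>\<^sub>L 'h)) \<Rightarrow> bool"
  where "operator_valued_norm V F \<longleftrightarrow>
    F \<in> carrier V \<rightarrow> bounded_operators \<and>
    (\<forall>x\<in>carrier V. 0 \<le>\<^sub>L F x) \<and>
    (\<forall>x\<in>carrier V. \<forall>y\<in>carrier V. F (x \<oplus>\<^bsub>V\<^esub> y) \<le>\<^sub>L F x + F y) \<and>
    (\<forall>c. \<forall>x\<in>carrier V. F (c \<odot>\<^bsub>V\<^esub> x) = cmod c *\<^sub>R F x) \<and>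
    (\<forall>x\<in>carrier V. F x = 0 \<longleftrightarrow> x = \<zero>\<^bsub>V\<^esub>)"

definition operator_Cauchy ::
    "(complex, 'x, 'm) module_scheme \<Rightarrow> ('x \<Rightarrow> ('h :: complex_hilbert \<Rightarrow>\<^sub>L 'h)) \<Rightarrow>
     (nat \<Rightarrow> 'x) \<Rightarrow> bool"
  where "operator_Cauchy V F x \<longleftrightarrow>
    (\<forall>\<epsilon>>0. \<exists>N. \<forall>n\<ge>N. \<forall>m\<ge>N. F (x n \<ominus>\<^bsub>V\<^esub> x m) \<le>\<^sub>L \<epsilon> *\<^sub>R id_blinfun)"

definition operator_converges ::
    "(complex, 'x, 'm) module_scheme \<Rightarrow> ('x \<Rightarrow> ('h :: complex_hilbert \<Rightarrow>\<^sub>L 'h)) \<Rightarrow>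
     (nat \<Rightarrow> 'x) \<Rightarrow> 'x \<Rightarrow> bool"
  where "operator_converges V F x l \<longleftrightarrow>
    (\<forall>\<epsilon>>0. \<exists>N. \<forall>n\<ge>N. F (x n \<ominus>\<^bsub>V\<^esub> l) \<le>\<^sub>L \<epsilon> *\<^sub>R id_blinfun)"

definition operator_complete ::
    "(complex, 'x, 'm) module_scheme \<Rightarrow> ('x \<Rightarrow> ('h :: complex_hilbert \<Rightarrow>\<^sub>L 'h)) \<Rightarrow> bool"
  where "operator_complete V F \<longleftrightarrow>
    (\<forall>x. (\<forall>n. x n \<in> carrier V) \<longrightarrow> operator_Cauchy V F x \<longrightarrow>
      (\<exists>l\<in>carrier V. operator_converges V F x l))"

definition banach_space_wrt ::
    "(complex, 'x, 'm) module_scheme \<Rightarrow> ('x \<Rightarrow> ('h :: complex_hilbert \<Rightarrow>\<^sub>L 'h)) \<Rightarrow> bool"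
  where "banach_space_wrt V F \<longleftrightarrow>
    complex_linear_space V \<and> operator_valued_norm V F \<and> operator_complete V F"


section \<open>The \<open>L(H)\<close>-dual space\<close>

definition operator_linear ::
    "(complex, 'x, 'm) module_scheme \<Rightarrow> ('x \<Rightarrow> ('h :: complex_hilbert \<Rightarrow>\<^sub>L 'h)) \<Rightarrow> bool"
  where "operator_linear V g \<longleftrightarrow>
    g \<in> carrier V \<rightarrow> bounded_operators \<and>
    (\<forall>x\<in>carrier V. \<forall>y\<in>carrier V. g (x \<oplus>\<^bsub>V\<^esub> y) = g x + g y) \<and>
    (\<forall>c. \<forall>x\<in>carrier V. g (c \<odot>\<^bsub>V\<^esub> x) = scale_operator c (g x))"

definition dual_norm ::
    "(complex, 'x, 'm) module_scheme \<Rightarrow> ('x \<Rightarrow> ('h :: complex_hilbert \<Rightarrow>\<^sub>L 'h)) \<Rightarrow>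
     ('x \<Rightarrow> ('h \<Rightarrow>\<^sub>L 'h)) \<Rightarrow> ennreal"
  where "dual_norm V F g = (SUP x\<in>carrier V - {\<zero>\<^bsub>V\<^esub>}. ennreal (norm (g x) / norm (F x)))"

text \<open>
  Functions on the carrier are represented by extensional functions, so that equality in the dual
  space is equality on the carrier. The ring fields \<open>mult\<close> and \<open>one\<close> of a module record play no
  role.
\<close>

definition operator_dual ::
    "(complex, 'x, 'm) module_scheme \<Rightarrow> ('x \<Rightarrow> ('h :: complex_hilbert \<Rightarrow>\<^sub>L 'h)) \<Rightarrow>
     (complex, 'x \<Rightarrow> ('h \<Rightarrow>\<^sub>L 'h)) module"
  where "operator_dual V F =
    \<lparr>carrier = {g \<in> extensional (carrier V). operator_linear V g \<and> dual_norm V F g < \<infinity>},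
     mult = undefined, one = undefined,
     zero = (\<lambda>x\<in>carrier V. 0),
     add = (\<lambda>f g. \<lambda>x\<in>carrier V. f x + g x),
     smult = (\<lambda>c g. \<lambda>x\<in>carrier V. scale_operator c (g x))\<rparr>"

definition annihilator ::
    "(complex, 'x, 'm) module_scheme \<Rightarrow> ('x \<Rightarrow> ('h :: complex_hilbert \<Rightarrow>\<^sub>L 'h)) \<Rightarrow> 'x \<Rightarrow>
     ('x \<Rightarrow> ('h \<Rightarrow>\<^sub>L 'h)) set"
  where "annihilator V F a = {\<phi> \<in> carrier (operator_dual V F). \<phi> a = 0}"


section \<open>Quotient spaces\<close>

text \<open>
  The analogue for modules of \<^const>\<open>FactRing\<close>; for a submodule \<open>N\<close>, the union defining the scalar
  multiplication consists of one and the same coset.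
\<close>

definition quotient_module ::
    "('r, 'x, 'm) module_scheme \<Rightarrow> 'x set \<Rightarrow> ('r, 'x set) module"
  where "quotient_module V N =
    \<lparr>carrier = a_rcosets\<^bsub>V\<^esub> N,
     mult = undefined, one = undefined,
     zero = N,
     add = set_add V,
     smult = (\<lambda>c C. \<Union>x\<in>C. N +>\<^bsub>V\<^esub> (c \<odot>\<^bsub>V\<^esub> x))\<rparr>"

definition quotient_norm ::
    "('x \<Rightarrow> ('h :: complex_hilbert \<Rightarrow>\<^sub>L 'h)) \<Rightarrow> 'x \<Rightarrow> ('x \<Rightarrow> ('h \<Rightarrow>\<^sub>L 'h)) set \<Rightarrow> ('h \<Rightarrow>\<^sub>L 'h)"
  where "quotient_norm F a C = norm ((SOME \<phi>. \<phi> \<in> C) a) *\<^sub>R F a"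

end

theory Submission
  imports Defs
begin

text \<open>
  Evaluation at \<open>a\<close> identifies the quotient of the dual space by the annihilator of \<open>a\<close> with a
  space of operators, and the quotient norm of a class is the operator norm of its value at \<open>a\<close>
  times the fixed nonzero positive operator \<open>F a\<close>. The axioms of an operator-valued norm are
  thereby inherited from the operator norm (\<open>quotient_norm_operator_valued_norm\<close>).

  For completeness the point is that evaluation at \<open>a\<close> reaches every complex-linear operator
  \<open>T\<close> (\<open>dual_interpolation\<close>): it suffices to have a complex-linear functional \<open>f\<close> on \<open>B\<close> with
  \<open>f a = 1\<close> that is dominated by a multiple of the norm of \<open>F x\<close>, because then
  \<open>\<phi> x = f x \<cdot> T\<close> is in the dual space and takes the value \<open>T\<close> at \<open>a\<close>. For a vector \<open>h\<close> the
  function \<open>x \<mapsto> (F x h, h)\<close> is a scalar seminorm on \<open>B\<close>, bounded by a multiple of the norm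
  of \<open>F x\<close>, and since \<open>F a\<close> is a nonzero operator on a complex space, polarization yields an \<open>h\<close>
  for which this seminorm is positive at \<open>a\<close>. The Hahn-Banach theorem for that seminorm
  provides \<open>f\<close>.

  A Cauchy sequence of classes has values at \<open>a\<close> that are Cauchy in operator norm: with \<open>h\<close> as
  above, comparing the quadratic forms at \<open>h\<close> bounds the norm of the difference of two values. The limit \<open>T\<close> of
  these values is again complex-linear, and the class of a \<open>\<phi>\<close> with \<open>\<phi> a = T\<close> is the limit of the
  sequence (\<open>quotient_norm_complete\<close>).

  The Hahn-Banach theorem is obtained without extending functionals from subspaces: among the
  sublinear functionals below a given one there is a minimal one by Zorn's lemma, and minimal
  sublinear functionals are linear.
\<close>

section \<open>The complex inner product and positive operators\<close>

lemma cinner_add_right: "cinner x (y + z) = cinner x y + cinner x (z :: 'a :: complex_inner)"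
  by (metis cinner_add_left cinner_commute complex_cnj_add)

lemma cinner_scaleC_right: "cinner x (c *\<^sub>C y) = cnj c * cinner x (y :: 'a :: complex_inner)"
  by (metis cinner_commute cinner_scaleC_left complex_cnj_mult)

lemma cinner_scaleR_left: "cinner (r *\<^sub>R x) y = of_real r * cinner x (y :: 'a :: complex_inner)"
  by (simp add: scaleR_scaleC cinner_scaleC_left)

lemma cinner_zero_left: "cinner 0 y = (0 :: complex)"
  for y :: "'a :: complex_inner"
  using cinner_scaleR_left[of 0 0 y] by simp

lemma cinner_diff_left: "cinner (x - y) z = cinner x z - cinner y (z :: 'a :: complex_inner)"
  using cinner_add_left[of "x - y" y z] by simp

lemma Re_cinner_self: "Re (cinner x x) = (norm x)\<^sup>2"
  for x :: "'a :: complex_inner"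
  using cinner_nonneg[of x]
  by (simp add: norm_eq_sqrt_cinner complex_nonneg_Reals_iff cmod_eq_Re)

text \<open>
  The real part of the Cauchy-Schwarz inequality is the triangle inequality of the norm, squared
  and expanded.
\<close>

lemma Re_cinner_le: "Re (cinner x y) \<le> norm x * norm y"
  for x y :: "'a :: complex_inner"
proof -
  have "Re (cinner y x) = Re (cinner x y)"
    by (subst cinner_commute) simp
  then have "(norm (x + y))\<^sup>2 = (norm x)\<^sup>2 + 2 * Re (cinner x y) + (norm y)\<^sup>2"
    by (simp add: Re_cinner_self[symmetric] cinner_add_left cinner_add_right)
  moreover have "(norm (x + y))\<^sup>2 \<le> (norm x + norm y)\<^sup>2"
    by (simp add: norm_triangle_ineq power_mono)
  ultimately show ?thesis
    by (simp add: power2_sum)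
qed

text \<open>
  Polarization with \<open>v\<close> and with \<open>\<i> v\<close> shows that both the sum and the difference of
  \<open>(P u, v)\<close> and \<open>(P v, u)\<close> vanish. The second half depends on complex scalars: a rotation of the
  real plane by a right angle has zero quadratic form.
\<close>

lemma operator_eq_zero_if_quadratic_form_zero:
  fixes P :: "'h :: complex_hilbert \<Rightarrow>\<^sub>L 'h"
  assumes P: "P \<in> bounded_operators" and zero: "\<And>h. cinner (blinfun_apply P h) h = 0"
  shows "P = 0"
proof (rule blinfun_eqI)
  fix h
  have polar: "cinner (P u) v + cinner (P v) u = 0" for u v
    using zero[of "u + v"] zero[of u] zero[of v]
    by (simp add: blinfun.add_right cinner_add_left cinner_add_right add.commute)
  have "cinner (P u) v = 0" for u v
  proof -
    have "P (\<i> *\<^sub>C v) = \<i> *\<^sub>C P v"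
      using P by (simp add: bounded_operators_def)
    then have "\<i> * (cinner (P v) u - cinner (P u) v) = 0"
      using polar[of u "\<i> *\<^sub>C v"]
      by (simp add: cinner_scaleC_left cinner_scaleC_right algebra_simps)
    then show ?thesis
      using polar[of u v] by simp
  qed
  then show "P h = (0 :: 'h \<Rightarrow>\<^sub>L 'h) h"
    using cinner_eq_zero_iff[of "P h"] by simp
qed

lemma bounded_operators_add:
  "S \<in> bounded_operators \<Longrightarrow> T \<in> bounded_operators \<Longrightarrow> S + T \<in> bounded_operators"
  by (simp add: bounded_operators_def blinfun.add_left scaleC_add_right)

lemma bounded_operators_scale: "T \<in> bounded_operators \<Longrightarrow> scale_operator c T \<in> bounded_operators"
  by (simp add: bounded_operators_def scale_operator.rep_eq scaleC_scaleC mult.commute)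

lemma scale_operator_of_real: "scale_operator (of_real r) T = r *\<^sub>R T"
  by (rule blinfun_eqI) (simp add: scale_operator.rep_eq scaleR_scaleC blinfun.scaleR_left)

lemma bounded_operators_scaleR: "T \<in> bounded_operators \<Longrightarrow> r *\<^sub>R T \<in> bounded_operators"
  by (metis bounded_operators_scale scale_operator_of_real)

lemma bounded_operators_zero: "0 \<in> bounded_operators"
  using scaleR_scaleC[of 0 "0 :: 'a"]
  by (auto simp: bounded_operators_def) (metis add_cancel_left_left scaleC_add_right)

lemma bounded_operators_minus: "T \<in> bounded_operators \<Longrightarrow> - T \<in> bounded_operators"
  using bounded_operators_scaleR[of T "-1"] by simp

lemma bounded_operators_id: "id_blinfun \<in> bounded_operators"
  by (simp add: bounded_operators_def)

lemma scale_operator_add_right: "scale_operator c (S + T) = scale_operator c S + scale_operator c T"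
  by (rule blinfun_eqI) (simp add: scale_operator.rep_eq blinfun.add_left scaleC_add_right)

lemma scale_operator_add_left: "scale_operator (c + d) T = scale_operator c T + scale_operator d T"
  by (rule blinfun_eqI) (simp add: scale_operator.rep_eq blinfun.add_left scaleC_add_left)

lemma scale_operator_scale_operator:
  "scale_operator c (scale_operator d T) = scale_operator (c * d) T"
  by (rule blinfun_eqI) (simp add: scale_operator.rep_eq scaleC_scaleC)

lemma scale_operator_one: "scale_operator 1 T = T"
  by (rule blinfun_eqI) (simp add: scale_operator.rep_eq scaleC_one)

lemma scale_operator_zero_left: "scale_operator 0 T = 0"
  using scale_operator_of_real[of 0 T] by simp

lemma scale_operator_zero_right: "scale_operator c 0 = 0"
  using scale_operator_add_right[of c 0 0] by simp

lemma scale_operator_minus_one: "scale_operator (- 1) T = - T"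
  using scale_operator_of_real[of "-1" T] by simp

lemma norm_scale_operator: "norm (scale_operator c T) = cmod c * norm T"
proof -
  have le: "norm (scale_operator d S) \<le> cmod d * norm S" for d and S :: "'h :: complex_hilbert \<Rightarrow>\<^sub>L 'h"
    by (rule norm_blinfun_bound)
      (auto simp: scale_operator.rep_eq norm_scaleC mult.assoc intro!: mult_left_mono norm_blinfun)
  show ?thesis
  proof (cases "c = 0")
    case False
    have "norm T \<le> cmod (inverse c) * norm (scale_operator c T)"
      using le[of "inverse c" "scale_operator c T"] False
      by (simp add: scale_operator_scale_operator scale_operator_one)
    then have "cmod c * norm T \<le> norm (scale_operator c T)"
      using False by (simp add: norm_inverse field_simps norm_divide)
    then show ?thesis
      using le[of c T] by simp
  qed (simp add: scale_operator_zero_left)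
qed

text \<open>
  Limits in the operator norm of real-linear operators stay complex-linear, because complex
  linearity is a family of pointwise equations between continuous functions of the operator.
\<close>

lemma closed_bounded_operators: "closed (bounded_operators :: ('h :: complex_hilbert \<Rightarrow>\<^sub>L 'h) set)"
proof -
  have "closed {T :: 'h \<Rightarrow>\<^sub>L 'h. blinfun_apply T (c *\<^sub>C h) = c *\<^sub>C blinfun_apply T h}" for c h
    by (intro closed_Collect_eq continuous_intros
        bounded_linear.continuous_on[OF bounded_linear_scaleC])
  then have "closed (\<Inter>c. \<Inter>h :: 'h. {T :: 'h \<Rightarrow>\<^sub>L 'h.
      blinfun_apply T (c *\<^sub>C h) = c *\<^sub>C blinfun_apply T h})"
    by (intro closed_INT ballI)
  also have "(\<Inter>c. \<Inter>h :: 'h. {T :: 'h \<Rightarrow>\<^sub>L 'h.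
      blinfun_apply T (c *\<^sub>C h) = c *\<^sub>C blinfun_apply T h}) = bounded_operators"
    by (auto simp: bounded_operators_def)
  finally show ?thesis .
qed

lemma positive_operator_scaleR: "positive_operator P \<Longrightarrow> 0 \<le> r \<Longrightarrow> positive_operator (r *\<^sub>R P)"
  by (auto simp: positive_operator_def bounded_operators_scaleR blinfun.scaleR_left
      cinner_scaleR_left complex_nonneg_Reals_iff)

lemma operator_le_quadratic_form:
  assumes "S \<le>\<^sub>L T"
  shows "Re (cinner (blinfun_apply S h) h) \<le> Re (cinner (blinfun_apply T h) h)"
  using assms by (simp add: operator_le_def positive_operator_def blinfun.diff_left
      cinner_diff_left complex_nonneg_Reals_iff)

lemma quadratic_form_le_norm:
  "Re (cinner (blinfun_apply P h) h) \<le> norm P * (norm h)\<^sup>2"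
  for P :: "'h :: complex_hilbert \<Rightarrow>\<^sub>L 'h"
proof -
  have "Re (cinner (P h) h) \<le> norm (P h) * norm h"
    by (rule Re_cinner_le)
  also have "\<dots> \<le> norm P * norm h * norm h"
    by (intro mult_right_mono norm_blinfun) simp
  finally show ?thesis
    by (simp add: power2_eq_square mult.assoc)
qed

text \<open>
  Convergence with respect to an operator-valued norm is measured by the order; this lemma
  derives it from convergence in the operator norm.
\<close>

lemma positive_operator_le_scaleR_id:
  fixes P :: "'h :: complex_hilbert \<Rightarrow>\<^sub>L 'h"
  assumes P: "positive_operator P" and le: "norm P \<le> e"
  shows "P \<le>\<^sub>L e *\<^sub>R id_blinfun"
proof -
  have "e *\<^sub>R id_blinfun - P \<in> bounded_operators"
    using P bounded_operators_add[OF bounded_operators_scaleR[OF bounded_operators_id, of e]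
        bounded_operators_minus[of P]]
    by (simp add: positive_operator_def)
  moreover have "cinner (blinfun_apply (e *\<^sub>R id_blinfun - P) h) h \<in> \<real>\<^sub>\<ge>\<^sub>0" for h
  proof -
    have "Re (cinner (P h) h) \<le> e * (norm h)\<^sup>2"
      using quadratic_form_le_norm[of P h] mult_right_mono[OF le, of "(norm h)\<^sup>2"] by simp
    moreover have "Im (cinner (P h) h) = 0" "Im (cinner h h) = 0"
      using P cinner_nonneg[of h] by (auto simp: positive_operator_def complex_nonneg_Reals_iff)
    ultimately show ?thesis
      by (simp add: blinfun.diff_left blinfun.scaleR_left cinner_diff_left cinner_scaleR_left
          complex_nonneg_Reals_iff Re_cinner_self)
  qed
  ultimately show ?thesis
    by (simp add: operator_le_def positive_operator_def)
qed

section \<open>A Hahn-Banach theorem for modules over the complex numbers\<close>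

lemma complex_ring_simps [simp]:
  "carrier complex_ring = UNIV"
  "x \<oplus>\<^bsub>complex_ring\<^esub> y = x + y"
  "x \<otimes>\<^bsub>complex_ring\<^esub> y = x * y"
  "\<zero>\<^bsub>complex_ring\<^esub> = 0"
  "\<one>\<^bsub>complex_ring\<^esub> = 1"
  by (simp_all add: ring_of_type_algebra_def)

locale complex_module = Module.module complex_ring V for V (structure)
begin

abbreviation real_smult :: "real \<Rightarrow> 'a \<Rightarrow> 'a"  (infixr \<open>\<cdot>\<close> 75)
  where "r \<cdot> x \<equiv> of_real r \<odot> x"

lemma smult_add_left: "x \<in> carrier V \<Longrightarrow> (c + d) \<odot> x = c \<odot> x \<oplus> d \<odot> x"
  using smult_l_distr[of c d x] by simp

lemma smult_smult: "x \<in> carrier V \<Longrightarrow> c \<odot> (d \<odot> x) = (c * d) \<odot> x"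
  using smult_assoc1[of c d x] by simp

lemma smult_mem_carrier [simp, intro]: "x \<in> carrier V \<Longrightarrow> c \<odot> x \<in> carrier V"
  using smult_closed[of c x] by simp

lemma smult_add_right:
  "x \<in> carrier V \<Longrightarrow> y \<in> carrier V \<Longrightarrow> c \<odot> (x \<oplus> y) = c \<odot> x \<oplus> c \<odot> y"
  using smult_r_distr[of c x y] by simp

lemma smult_1 [simp]: "x \<in> carrier V \<Longrightarrow> 1 \<odot> x = x"
  using smult_one[of x] by simp

lemma smult_0 [simp]: "x \<in> carrier V \<Longrightarrow> 0 \<odot> x = \<zero>"
  using smult_l_null[of x] by simp

lemma smult_zero [simp]: "c \<odot> \<zero> = \<zero>"
  using smult_r_null[of c] by simp

lemma smult_minus_one: "x \<in> carrier V \<Longrightarrow> (- 1) \<odot> x = \<ominus> x"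
  using smult_add_left[of x "-1" 1] by (simp add: minus_equality)

definition sublinear :: "('a \<Rightarrow> real) \<Rightarrow> bool"
  where "sublinear q \<longleftrightarrow>
    (\<forall>x\<in>carrier V. \<forall>y\<in>carrier V. q (x \<oplus> y) \<le> q x + q y) \<and>
    (\<forall>t\<ge>0. \<forall>x\<in>carrier V. q (t \<cdot> x) = t * q x)"

lemma sublinear_add:
  "sublinear q \<Longrightarrow> x \<in> carrier V \<Longrightarrow> y \<in> carrier V \<Longrightarrow> q (x \<oplus> y) \<le> q x + q y"
  by (simp add: sublinear_def)

lemma sublinear_scale: "sublinear q \<Longrightarrow> 0 \<le> t \<Longrightarrow> x \<in> carrier V \<Longrightarrow> q (t \<cdot> x) = t * q x"
  by (simp add: sublinear_def)

lemma sublinear_zero: "sublinear q \<Longrightarrow> q \<zero> = 0"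
  using sublinear_scale[of q 0 \<zero>] by simp

lemma sublinear_ge: "sublinear q \<Longrightarrow> x \<in> carrier V \<Longrightarrow> - q (\<ominus> x) \<le> q x"
  using sublinear_add[of q x "\<ominus> x"] sublinear_zero[of q] by (simp add: r_neg)

text \<open>
  One inequality suffices for positive homogeneity, since applying it to \<open>1 / t\<close> gives the
  other one.
\<close>

lemma sublinearI:
  assumes add: "\<And>x y. x \<in> carrier V \<Longrightarrow> y \<in> carrier V \<Longrightarrow> q (x \<oplus> y) \<le> q x + q y"
    and zero: "q \<zero> = 0"
    and scale: "\<And>t x. 0 < t \<Longrightarrow> x \<in> carrier V \<Longrightarrow> q (t \<cdot> x) \<le> t * q x"
  shows "sublinear q"
proof -
  have "q (t \<cdot> x) = t * q x" if t: "0 \<le> t" and x: "x \<in> carrier V" for t x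
  proof (cases "t = 0")
    case False
    then have "q x \<le> inverse t * q (t \<cdot> x)"
      using scale[of "inverse t" "t \<cdot> x"] t x by (simp add: smult_smult)
    then have "t * q x \<le> q (t \<cdot> x)"
      using False t by (simp add: field_simps)
    then show ?thesis
      using scale[of t x] False t x by simp
  qed (simp add: x zero)
  then show ?thesis
    using add by (simp add: sublinear_def)
qed

text \<open>
  The minorant is the infimum over \<open>t \<ge> 0\<close> of \<open>q (x + t y) - t q y\<close>, which is finite since each
  term is at least \<open>- q (- x)\<close>; the terms for \<open>t = 0\<close> and \<open>t = 1\<close> give the two bounds. The
  second bound says that \<open>r\<close> is superadditive in the direction \<open>y\<close> relative to \<open>q\<close>. It is used
  twice below: to show that a minimal \<open>q\<close>, for which \<open>r = q\<close>, is additive, and to force a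
  linear minorant to attain the value of \<open>q\<close> at \<open>y\<close>.
\<close>

lemma sublinear_directional_minorant:
  assumes q: "sublinear q" and y: "y \<in> carrier V"
  obtains r where "sublinear r" "\<And>x. x \<in> carrier V \<Longrightarrow> r x \<le> q x"
    "\<And>x. x \<in> carrier V \<Longrightarrow> r x \<le> q (x \<oplus> y) - q y"
proof -
  define g where "g t x = q (x \<oplus> t \<cdot> y) - t * q y" for t x
  define r where "r x = (INF t\<in>{0..}. g t x)" for x
  have bound: "- q (\<ominus> x) \<le> g t x" if "0 \<le> t" "x \<in> carrier V" for t x
  proof -
    have "\<ominus> x \<oplus> (x \<oplus> t \<cdot> y) = t \<cdot> y"
      using that y by (simp add: r_neg1)
    then show ?thesis
      using sublinear_add[OF q, of "\<ominus> x" "x \<oplus> t \<cdot> y"] sublinear_scale[OF q, of t y] that y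
      by (simp add: g_def)
  qed
  have le: "r x \<le> g t x" if "0 \<le> t" "x \<in> carrier V" for t x
    unfolding r_def using that bound
    by (intro cINF_lower) (auto simp: bdd_below_def)
  have ge: "c \<le> r x" if "\<And>t. 0 \<le> t \<Longrightarrow> c \<le> g t x" for c x
    unfolding r_def using that by (intro cINF_greatest) auto
  have "sublinear r"
  proof (rule sublinearI)
    fix x1 x2 assume x: "x1 \<in> carrier V" "x2 \<in> carrier V"
    have "r (x1 \<oplus> x2) \<le> g s x1 + g t x2" if st: "0 \<le> s" "0 \<le> t" for s t
    proof -
      have "(x1 \<oplus> x2) \<oplus> (s + t) \<cdot> y = (x1 \<oplus> s \<cdot> y) \<oplus> (x2 \<oplus> t \<cdot> y)"
        using x y by (simp add: smult_add_left a_ac)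
      then have "g (s + t) (x1 \<oplus> x2) \<le> g s x1 + g t x2"
        using sublinear_add[OF q, of "x1 \<oplus> s \<cdot> y" "x2 \<oplus> t \<cdot> y"] x y
        by (simp add: g_def algebra_simps)
      then show ?thesis
        using le[of "s + t" "x1 \<oplus> x2"] st x by simp
    qed
    then have "r (x1 \<oplus> x2) - g s x1 \<le> r x2" if "0 \<le> s" for s
      using that by (intro ge) (simp add: diff_le_eq add.commute[of _ "g s x1"])
    then have "r (x1 \<oplus> x2) - r x2 \<le> r x1"
      by (intro ge) (simp add: diff_le_eq add.commute[of _ "r x2"])
    then show "r (x1 \<oplus> x2) \<le> r x1 + r x2"
      by simp
  next
    have "g t \<zero> = 0" if "0 \<le> t" for t
      using sublinear_scale[OF q that y] y by (simp add: g_def)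
    then show "r \<zero> = 0"
      using le[of 0 \<zero>] ge[of 0 \<zero>] by simp
  next
    fix t :: real and x assume t: "0 < t" and x: "x \<in> carrier V"
    have "r (t \<cdot> x) / t \<le> g s x" if s: "0 \<le> s" for s
    proof -
      have "t \<cdot> x \<oplus> (t * s) \<cdot> y = t \<cdot> (x \<oplus> s \<cdot> y)"
        using x y by (simp add: smult_add_right smult_smult)
      then have "g (t * s) (t \<cdot> x) = t * g s x"
        using sublinear_scale[OF q, of t "x \<oplus> s \<cdot> y"] t x y by (simp add: g_def algebra_simps)
      then show ?thesis
        using le[of "t * s" "t \<cdot> x"] s t x by (simp add: field_simps)
    qed
    then have "r (t \<cdot> x) / t \<le> r x"
      by (rule ge)
    then show "r (t \<cdot> x) \<le> t * r x"
      using t by (simp add: field_simps)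
  qed
  moreover have "r x \<le> q x" "r x \<le> q (x \<oplus> y) - q y" if "x \<in> carrier V" for x
    using le[of 0 x] le[of 1 x] that y by (simp_all add: g_def)
  ultimately show thesis
    using that by blast
qed

text \<open>
  A sublinear functional that is minimal for the pointwise order is linear: its minorant in any
  direction \<open>y\<close> coincides with it. Minimal functionals exist by Zorn's lemma, since the
  pointwise infimum of a chain of sublinear functionals below \<open>q\<close> is finite, being at least
  \<open>- q (- x)\<close>, and sublinear.
\<close>

lemma real_linear_minorant_of_sublinear:
  assumes q: "sublinear q"
  obtains m where "\<And>x y. x \<in> carrier V \<Longrightarrow> y \<in> carrier V \<Longrightarrow> m (x \<oplus> y) = m x + m y"
    "\<And>t x. x \<in> carrier V \<Longrightarrow> m (t \<cdot> x) = t * m x"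
    "\<And>x. x \<in> carrier V \<Longrightarrow> m x \<le> q x"
proof -
  \<comment> \<open>Functionals are set to zero off the carrier, so that on \<open>S\<close> the order of functions is
    the pointwise order on the carrier.\<close>
  define S where "S = {r. sublinear r \<and> (\<forall>x\<in>carrier V. r x \<le> q x) \<and> (\<forall>x. x \<notin> carrier V \<longrightarrow> r x = 0)}"
  define cut where "cut r x = (if x \<in> carrier V then r x else 0)" for r :: "'a \<Rightarrow> real" and x
  have cut: "cut r \<in> S" if "sublinear r" "\<And>x. x \<in> carrier V \<Longrightarrow> r x \<le> q x" for r
    using that by (auto simp: S_def cut_def sublinear_def)
  have low: "- q (\<ominus> x) \<le> r x" if "r \<in> S" "x \<in> carrier V" for r x
  proof -
    have "r (\<ominus> x) \<le> q (\<ominus> x)" "- r (\<ominus> x) \<le> r x"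
      using that sublinear_ge[of r x] by (auto simp: S_def)
    then show ?thesis
      by linarith
  qed
  have "\<exists>m\<in>S. \<forall>r\<in>S. r \<le> m \<longrightarrow> r = m"
  proof (rule predicate_Zorn)
    show "partial_order_on S (relation_of (\<lambda>m r. r \<le> m) S)"
      by (rule partial_order_on_relation_ofI) auto
  next
    fix C assume C: "C \<in> Chains (relation_of (\<lambda>m r. r \<le> m) S)"
    have sub: "C \<subseteq> S" and tot: "\<And>r s. r \<in> C \<Longrightarrow> s \<in> C \<Longrightarrow> r \<le> s \<or> s \<le> r"
      using C by (auto simp: Chains_def relation_of_def)
    show "\<exists>u\<in>S. \<forall>r\<in>C. u \<le> r"
    proof (cases "C = {}")
      case True
      then show ?thesis
        using cut[OF q] by auto
    next
      case False
      define u where "u x = (INF r\<in>C. r x)" for x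
      have le: "u x \<le> r x" if "r \<in> C" "x \<in> carrier V" for r x
        unfolding u_def using that sub low[of _ x] by (intro cINF_lower) (auto simp: bdd_below_def)
      have ge: "c \<le> u x" if "\<And>r. r \<in> C \<Longrightarrow> c \<le> r x" for c x
        unfolding u_def using that False by (intro cINF_greatest) auto
      have sublin: "sublinear r" if "r \<in> C" for r
        using that sub by (auto simp: S_def)
      obtain r0 where r0: "r0 \<in> C"
        using False by blast
      have "sublinear u"
      proof (rule sublinearI)
        fix x y assume x: "x \<in> carrier V" and y: "y \<in> carrier V"
        have "u (x \<oplus> y) \<le> r x + s y" if rs: "r \<in> C" "s \<in> C" for r s
        proof -
          \<comment> \<open>In a chain, the smaller of \<open>r\<close> and \<open>s\<close> serves both arguments.\<close>
          obtain t where "t \<in> C" "t \<le> r" "t \<le> s"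
            using tot[OF rs] rs by blast
          then show ?thesis
            using le[of t "x \<oplus> y"] sublinear_add[OF sublin, of t x y] x y
            by (smt (verit) a_closed le_funD)
        qed
        then have "u (x \<oplus> y) - r x \<le> u y" if "r \<in> C" for r
          using that by (intro ge) (simp add: diff_le_eq add.commute[of _ "r x"])
        then have "u (x \<oplus> y) - u y \<le> u x"
          by (intro ge) (simp add: diff_le_eq add.commute[of _ "u y"])
        then show "u (x \<oplus> y) \<le> u x + u y"
          by simp
      next
        have zero: "r \<zero> = 0" if "r \<in> C" for r
          using sublinear_zero sublin that by blast
        have "u \<zero> \<le> 0"
          using le[OF r0, of \<zero>] zero[OF r0] by simp
        moreover have "0 \<le> u \<zero>"
          by (rule ge) (simp add: zero)
        ultimately show "u \<zero> = 0"
          by simp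
      next
        fix t :: real and x assume t: "0 < t" and x: "x \<in> carrier V"
        have "u (t \<cdot> x) / t \<le> r x" if r: "r \<in> C" for r
          using le[OF r, of "t \<cdot> x"] sublinear_scale[OF sublin[OF r], of t x] t x
          by (simp add: field_simps)
        then have "u (t \<cdot> x) / t \<le> u x"
          by (rule ge)
        then show "u (t \<cdot> x) \<le> t * u x"
          using t by (simp add: field_simps)
      qed
      moreover have "u x \<le> q x" if "x \<in> carrier V" for x
        using le[OF r0 that] r0 sub that by (force simp: S_def)
      ultimately have "cut u \<in> S"
        by (rule cut)
      moreover have "cut u \<le> r" if "r \<in> C" for r
        using le[OF that] that sub by (auto simp: le_fun_def cut_def S_def)
      ultimately show ?thesis
        by blast
    qed
  qed
  then obtain m where m: "m \<in> S" and min: "\<And>r. r \<in> S \<Longrightarrow> r \<le> m \<Longrightarrow> r = m"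
    by blast
  have sublin: "sublinear m" and le: "\<And>x. x \<in> carrier V \<Longrightarrow> m x \<le> q x"
    using m by (auto simp: S_def)
  have add: "m (x \<oplus> y) = m x + m y" if x: "x \<in> carrier V" and y: "y \<in> carrier V" for x y
  proof -
    obtain r where r: "sublinear r" "\<And>x. x \<in> carrier V \<Longrightarrow> r x \<le> m x"
      "\<And>x. x \<in> carrier V \<Longrightarrow> r x \<le> m (x \<oplus> y) - m y"
      using sublinear_directional_minorant[OF sublin y] by blast
    have "cut r = m"
    proof (rule min)
      show "cut r \<in> S"
        using r(1,2) le by (intro cut) (auto intro: order_trans)
      show "cut r \<le> m"
        using r(2) m by (auto simp: le_fun_def cut_def S_def)
    qed
    then have "m x = r x"
      using x by (metis cut_def)
    then show ?thesis
      using r(3)[OF x] sublinear_add[OF sublin x y] by simp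
  qed
  have minus: "m (\<ominus> x) = - m x" if "x \<in> carrier V" for x
    using add[of x "\<ominus> x"] sublinear_zero[OF sublin] that by (simp add: r_neg)
  have "m (t \<cdot> x) = t * m x" if x: "x \<in> carrier V" for t x
  proof (cases "0 \<le> t")
    case False
    have "t \<cdot> x = \<ominus> ((- t) \<cdot> x)"
      using x by (simp add: smult_minus_one[symmetric] smult_smult)
    then show ?thesis
      using sublinear_scale[OF sublin, of "- t" x] False x minus[of "(- t) \<cdot> x"] by simp
  qed (simp add: sublinear_scale[OF sublin] x)
  then show thesis
    using that add le by blast
qed

text \<open>
  A real-linear \<open>m\<close> below the minorant of \<open>p\<close> in the direction \<open>a\<close> satisfies
  \<open>m (- a) \<le> p 0 - p a\<close> and hence \<open>m a = p a\<close>. It is the real part of the complex-linear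
  functional \<open>f x = m x - \<i> m (\<i> x)\<close>, and rotating \<open>x\<close> so that \<open>f x\<close> becomes real and
  nonnegative turns the bound on the real part into a bound on the modulus.
\<close>

lemma norming_functional_of_seminorm:
  assumes add: "\<And>x y. x \<in> carrier V \<Longrightarrow> y \<in> carrier V \<Longrightarrow> p (x \<oplus> y) \<le> p x + p y"
    and scale: "\<And>c x. x \<in> carrier V \<Longrightarrow> p (c \<odot> x) = cmod c * p x"
    and a: "a \<in> carrier V"
  obtains f :: "'a \<Rightarrow> complex"
  where "\<And>x y. x \<in> carrier V \<Longrightarrow> y \<in> carrier V \<Longrightarrow> f (x \<oplus> y) = f x + f y"
    "\<And>c x. x \<in> carrier V \<Longrightarrow> f (c \<odot> x) = c * f x"
    "\<And>x. x \<in> carrier V \<Longrightarrow> cmod (f x) \<le> p x"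
    "f a = of_real (p a)"
proof -
  have "sublinear p"
    using add scale by (simp add: sublinear_def)
  then obtain r where r: "sublinear r" "\<And>x. x \<in> carrier V \<Longrightarrow> r x \<le> p x"
    "\<And>x. x \<in> carrier V \<Longrightarrow> r x \<le> p (x \<oplus> a) - p a"
    using sublinear_directional_minorant[OF _ a] by blast
  obtain m where m_add: "\<And>x y. x \<in> carrier V \<Longrightarrow> y \<in> carrier V \<Longrightarrow> m (x \<oplus> y) = m x + m y"
    and m_scale: "\<And>t x. x \<in> carrier V \<Longrightarrow> m (t \<cdot> x) = t * m x"
    and m_le: "\<And>x. x \<in> carrier V \<Longrightarrow> m x \<le> r x"
    using real_linear_minorant_of_sublinear[OF r(1)] by blast
  have m_p: "m x \<le> p x" if "x \<in> carrier V" for x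
    using m_le r(2) that order_trans by blast
  have m_a: "p a \<le> m a"
  proof -
    have "p \<zero> = 0"
      using scale[of \<zero> 0] by simp
    then have "m (\<ominus> a) \<le> - p a"
      using m_le[of "\<ominus> a"] r(3)[of "\<ominus> a"] a by (simp add: l_neg)
    moreover have "m (\<ominus> a) = - m a"
      using m_scale[of a "-1"] a by (simp add: smult_minus_one)
    ultimately show ?thesis
      by simp
  qed
  define f where "f x = Complex (m x) (- m (\<i> \<odot> x))" for x
  have f_add: "f (x \<oplus> y) = f x + f y" if "x \<in> carrier V" "y \<in> carrier V" for x y
    using that by (simp add: f_def m_add smult_add_right complex_eq_iff)
  have f_scale: "f (c \<odot> x) = c * f x" if x: "x \<in> carrier V" for c x
  proof -
    have split: "m (d \<odot> x) = Re d * m x + Im d * m (\<i> \<odot> x)" for d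
    proof -
      have "d = of_real (Re d) + of_real (Im d) * \<i>"
        by (simp add: complex_eq_iff)
      then have "d \<odot> x = Re d \<cdot> x \<oplus> Im d \<cdot> (\<i> \<odot> x)"
        using x by (metis smult_add_left smult_smult)
      then show ?thesis
        using x by (simp add: m_add m_scale)
    qed
    show ?thesis
      using x by (simp add: f_def smult_smult split[of c] split[of "\<i> * c"] complex_eq_iff algebra_simps)
  qed
  have f_le: "cmod (f x) \<le> p x" if x: "x \<in> carrier V" for x
  proof (cases "f x = 0")
    case True
    have "0 \<le> p x"
      using add[of x "\<ominus> x"] scale[of x "-1"] scale[of x 0] x
      by (simp add: r_neg smult_minus_one)
    then show ?thesis
      using True by simp
  next
    case False
    define c where "c = cnj (f x) / of_real (cmod (f x))"
    have c: "cmod c = 1"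
      using False by (simp add: c_def norm_divide)
    have "c * f x = of_real (cmod (f x))"
      using False complex_norm_square[of "f x"]
      by (simp add: c_def power2_eq_square divide_eq_eq mult.commute)
    then have "cmod (f x) = Re (f (c \<odot> x))"
      using f_scale[OF x] by simp
    also have "\<dots> \<le> p (c \<odot> x)"
      using m_p[of "c \<odot> x"] x by (simp add: f_def)
    finally show ?thesis
      using scale[OF x] c by simp
  qed
  have "f a = of_real (p a)"
  proof -
    have "p a \<le> Re (f a)"
      using m_a by (simp add: f_def)
    moreover have "Re (f a) \<le> p a"
      using m_p[OF a] by (simp add: f_def)
    ultimately have Re: "Re (f a) = p a"
      by simp
    have "(Re (f a))\<^sup>2 + (Im (f a))\<^sup>2 \<le> (p a)\<^sup>2"
      using power_mono[OF f_le[OF a], of 2] by (simp add: cmod_power2)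
    then show ?thesis
      using Re by (simp add: complex_eq_iff)
  qed
  then show thesis
    using that f_add f_scale f_le by blast
qed

end

section \<open>Quotient modules\<close>

context Module.module
begin

lemma abelian_subgroup_submodule: "submodule N R M \<Longrightarrow> abelian_subgroup N M"
  by (intro abelian_subgroupI3 additive_subgroup.intro M.abelian_group_axioms)
    (simp add: submodule_def)

lemma quotient_module_carrier: "carrier (quotient_module M N) = {N +>\<^bsub>M\<^esub> x |x. x \<in> carrier M}"
  by (auto simp: quotient_module_def A_RCOSETS_def')

lemma quotient_module_zero: "\<zero>\<^bsub>quotient_module M N\<^esub> = N"
  by (simp add: quotient_module_def)

lemma quotient_module_add:
  assumes "submodule N R M" "x \<in> carrier M" "y \<in> carrier M"
  shows "(N +>\<^bsub>M\<^esub> x) \<oplus>\<^bsub>quotient_module M N\<^esub> (N +>\<^bsub>M\<^esub> y) = N +>\<^bsub>M\<^esub> (x \<oplus>\<^bsub>M\<^esub> y)"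
  using abelian_subgroup.a_rcos_sum[OF abelian_subgroup_submodule] assms
  by (simp add: quotient_module_def)

lemma coset_mem_iff:
  assumes "submodule N R M" "x \<in> carrier M"
  shows "y \<in> N +>\<^bsub>M\<^esub> x \<longleftrightarrow> y \<in> carrier M \<and> y \<ominus>\<^bsub>M\<^esub> x \<in> N"
proof
  have N: "N \<subseteq> carrier M"
    using assms submoduleE(1) by blast
  show "y \<in> N +>\<^bsub>M\<^esub> x \<Longrightarrow> y \<in> carrier M \<and> y \<ominus>\<^bsub>M\<^esub> x \<in> N"
    using N assms by (auto simp: a_r_coset_def' a_minus_def a_assoc r_neg)
  show "y \<in> carrier M \<and> y \<ominus>\<^bsub>M\<^esub> x \<in> N \<Longrightarrow> y \<in> N +>\<^bsub>M\<^esub> x"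
    using N assms by (auto simp: a_r_coset_def' a_minus_def a_assoc l_neg intro!: bexI[of _ "y \<oplus>\<^bsub>M\<^esub> \<ominus>\<^bsub>M\<^esub> x"])
qed

lemma coset_eq_iff:
  assumes "submodule N R M" "x \<in> carrier M" "y \<in> carrier M"
  shows "N +>\<^bsub>M\<^esub> x = N +>\<^bsub>M\<^esub> y \<longleftrightarrow> x \<ominus>\<^bsub>M\<^esub> y \<in> N"
proof
  interpret abelian_subgroup N M
    using assms(1) by (rule abelian_subgroup_submodule)
  show "N +>\<^bsub>M\<^esub> x = N +>\<^bsub>M\<^esub> y \<Longrightarrow> x \<ominus>\<^bsub>M\<^esub> y \<in> N"
    using a_rcos_self[of x] assms coset_mem_iff by blast
  show "x \<ominus>\<^bsub>M\<^esub> y \<in> N \<Longrightarrow> N +>\<^bsub>M\<^esub> x = N +>\<^bsub>M\<^esub> y"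
    using assms coset_mem_iff[OF assms(1,3), of x] a_repr_independence[of x N y] a_subgroup
    by metis
qed

text \<open>
  All members of the union that defines the product are the same coset, because multiplying two
  congruent elements by \<open>c\<close> gives congruent elements.
\<close>

lemma quotient_module_smult:
  assumes N: "submodule N R M" and c: "c \<in> carrier R" and x: "x \<in> carrier M"
  shows "c \<odot>\<^bsub>quotient_module M N\<^esub> (N +>\<^bsub>M\<^esub> x) = N +>\<^bsub>M\<^esub> (c \<odot>\<^bsub>M\<^esub> x)"
proof -
  interpret abelian_subgroup N M
    using N by (rule abelian_subgroup_submodule)
  have "N +>\<^bsub>M\<^esub> (c \<odot>\<^bsub>M\<^esub> y) = N +>\<^bsub>M\<^esub> (c \<odot>\<^bsub>M\<^esub> x)" if "y \<in> N +>\<^bsub>M\<^esub> x" for y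
  proof -
    have y: "y \<in> carrier M" "y \<ominus>\<^bsub>M\<^esub> x \<in> N"
      using that coset_mem_iff[OF N x] by auto
    have "c \<odot>\<^bsub>M\<^esub> y \<ominus>\<^bsub>M\<^esub> c \<odot>\<^bsub>M\<^esub> x = c \<odot>\<^bsub>M\<^esub> (y \<ominus>\<^bsub>M\<^esub> x)"
      using c x y(1) by (simp add: a_minus_def smult_r_distr smult_r_minus)
    then show ?thesis
      using y c x submoduleE(4)[OF N c y(2)] coset_eq_iff[OF N] by simp
  qed
  then have "(\<Union>y\<in>N +>\<^bsub>M\<^esub> x. N +>\<^bsub>M\<^esub> (c \<odot>\<^bsub>M\<^esub> y)) = (\<Union>y\<in>N +>\<^bsub>M\<^esub> x. N +>\<^bsub>M\<^esub> (c \<odot>\<^bsub>M\<^esub> x))"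
    by (intro SUP_cong refl)
  also have "\<dots> = N +>\<^bsub>M\<^esub> (c \<odot>\<^bsub>M\<^esub> x)"
    using a_rcos_self[OF x] by (intro SUP_const) blast
  finally show ?thesis
    by (simp add: quotient_module_def)
qed

lemma quotient_module_module:
  assumes N: "submodule N R M"
  shows "Module.module R (quotient_module M N)"
proof -
  interpret N: abelian_subgroup N M
    using N by (rule abelian_subgroup_submodule)
  note simps = quotient_module_add[OF N] quotient_module_smult[OF N]
  have zero: "\<zero>\<^bsub>quotient_module M N\<^esub> = N +>\<^bsub>M\<^esub> \<zero>\<^bsub>M\<^esub>"
    using N.a_subset by (simp add: quotient_module_zero)
  have group: "abelian_group (quotient_module M N)"
  proof (rule abelian_groupI)
    fix C assume "C \<in> carrier (quotient_module M N)"
    then obtain x where x: "x \<in> carrier M" "C = N +>\<^bsub>M\<^esub> x"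
      by (auto simp: quotient_module_carrier)
    then show "\<exists>D\<in>carrier (quotient_module M N). D \<oplus>\<^bsub>quotient_module M N\<^esub> C = \<zero>\<^bsub>quotient_module M N\<^esub>"
      by (intro bexI[of _ "N +>\<^bsub>M\<^esub> \<ominus>\<^bsub>M\<^esub> x"])
        (auto simp: simps zero l_neg quotient_module_carrier)
  qed (auto simp: quotient_module_carrier simps zero a_ac)
  show ?thesis
    by (rule moduleI[OF R.is_cring group])
      (auto simp: quotient_module_carrier simps smult_l_distr smult_r_distr smult_assoc1)
qed

lemma quotient_module_minus:
  assumes N: "submodule N R M" and x: "x \<in> carrier M" and y: "y \<in> carrier M"
  shows "(N +>\<^bsub>M\<^esub> x) \<ominus>\<^bsub>quotient_module M N\<^esub> (N +>\<^bsub>M\<^esub> y) = N +>\<^bsub>M\<^esub> (x \<ominus>\<^bsub>M\<^esub> y)"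
proof -
  interpret Q: Module.module R "quotient_module M N"
    using N by (rule quotient_module_module)
  interpret N: abelian_subgroup N M
    using N by (rule abelian_subgroup_submodule)
  have "(N +>\<^bsub>M\<^esub> \<ominus>\<^bsub>M\<^esub> y) \<oplus>\<^bsub>quotient_module M N\<^esub> (N +>\<^bsub>M\<^esub> y) = \<zero>\<^bsub>quotient_module M N\<^esub>"
    using y N.a_subset by (simp add: quotient_module_add[OF N] l_neg quotient_module_zero)
  then have "\<ominus>\<^bsub>quotient_module M N\<^esub> (N +>\<^bsub>M\<^esub> y) = N +>\<^bsub>M\<^esub> \<ominus>\<^bsub>M\<^esub> y"
    using y by (intro Q.minus_equality) (auto simp: quotient_module_carrier)
  then show ?thesis
    using x y by (simp add: a_minus_def quotient_module_add[OF N])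
qed

end

section \<open>The dual space and evaluation at a point\<close>

locale operator_normed_space = complex_module B
  for B :: "(complex, 'b, 'm) module_scheme" (structure)
    and F :: "'b \<Rightarrow> ('h :: complex_hilbert \<Rightarrow>\<^sub>L 'h)" +
  assumes operator_norm: "operator_valued_norm B F"
begin

abbreviation dual where "dual \<equiv> operator_dual B F"

lemma F_positive: "x \<in> carrier B \<Longrightarrow> positive_operator (F x)"
  using operator_norm by (auto simp: operator_valued_norm_def operator_le_def)

lemma F_zero_iff: "x \<in> carrier B \<Longrightarrow> F x = 0 \<longleftrightarrow> x = \<zero>"
  using operator_norm by (auto simp: operator_valued_norm_def)

lemma operator_linear_zero: "operator_linear B g \<Longrightarrow> g \<zero> = 0"
  by (metis operator_linear_def scale_operator_zero_left smult_0 zero_closed)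

text \<open>
  Membership in the dual space by an explicit bound, which replaces the supremum of quotients.
  At the zero vector, which the supremum leaves out, both sides of the bound vanish.
\<close>

lemma operator_dual_iff:
  "g \<in> carrier dual \<longleftrightarrow> g \<in> extensional (carrier B) \<and> operator_linear B g \<and>
    (\<exists>K. \<forall>x\<in>carrier B. norm (g x) \<le> K * norm (F x))"
proof -
  have "dual_norm B F g < \<infinity> \<longleftrightarrow> (\<exists>K. \<forall>x\<in>carrier B. norm (g x) \<le> K * norm (F x))"
    if lin: "operator_linear B g"
  proof
    assume "dual_norm B F g < \<infinity>"
    then obtain K where K: "0 \<le> K" "dual_norm B F g = ennreal K"
      by (cases "dual_norm B F g") auto
    have "norm (g x) \<le> K * norm (F x)" if x: "x \<in> carrier B" for x
    proof (cases "x = \<zero>")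
      case True
      then show ?thesis
        using operator_linear_zero[OF lin] K by simp
    next
      case False
      then have "ennreal (norm (g x) / norm (F x)) \<le> ennreal K"
        using x unfolding K(2)[symmetric] dual_norm_def by (intro SUP_upper) auto
      then show ?thesis
        using K(1) False F_zero_iff[OF x] by (simp add: field_simps)
    qed
    then show "\<exists>K. \<forall>x\<in>carrier B. norm (g x) \<le> K * norm (F x)"
      by blast
  next
    assume "\<exists>K. \<forall>x\<in>carrier B. norm (g x) \<le> K * norm (F x)"
    then obtain K where K: "\<And>x. x \<in> carrier B \<Longrightarrow> norm (g x) \<le> K * norm (F x)"
      by blast
    have "dual_norm B F g \<le> ennreal K"
      unfolding dual_norm_def
    proof (rule SUP_least)
      fix x assume "x \<in> carrier B - {\<zero>}"
      then show "ennreal (norm (g x) / norm (F x)) \<le> ennreal K"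
        using K[of x] F_zero_iff[of x] by (intro ennreal_leI) (simp add: field_simps)
    qed
    then show "dual_norm B F g < \<infinity>"
      by (simp add: order_le_less_trans ennreal_less_top)
  qed
  then show ?thesis
    by (auto simp: operator_dual_def)
qed

lemma dual_zero: "\<zero>\<^bsub>dual\<^esub> = (\<lambda>x\<in>carrier B. 0)"
  and dual_add: "g \<oplus>\<^bsub>dual\<^esub> k = (\<lambda>x\<in>carrier B. g x + k x)"
  and dual_smult: "c \<odot>\<^bsub>dual\<^esub> g = (\<lambda>x\<in>carrier B. scale_operator c (g x))"
  by (simp_all add: operator_dual_def)

lemma dual_apply:
  assumes "x \<in> carrier B"
  shows "\<zero>\<^bsub>dual\<^esub> x = 0" "(g \<oplus>\<^bsub>dual\<^esub> k) x = g x + k x"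
    "(c \<odot>\<^bsub>dual\<^esub> g) x = scale_operator c (g x)"
  using assms by (simp_all add: dual_zero dual_add dual_smult)

lemma dual_zero_closed: "\<zero>\<^bsub>dual\<^esub> \<in> carrier dual"
  by (auto simp: operator_dual_iff dual_zero operator_linear_def bounded_operators_zero
      scale_operator_zero_right intro: exI[of _ 0])

lemma dual_add_closed:
  assumes "g \<in> carrier dual" "k \<in> carrier dual"
  shows "g \<oplus>\<^bsub>dual\<^esub> k \<in> carrier dual"
proof -
  obtain K L where "\<forall>x\<in>carrier B. norm (g x) \<le> K * norm (F x)"
    "\<forall>x\<in>carrier B. norm (k x) \<le> L * norm (F x)"
    using assms by (auto simp: operator_dual_iff)
  then have "\<forall>x\<in>carrier B. norm (g x + k x) \<le> (K + L) * norm (F x)"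
    by (simp add: distrib_right norm_add_rule_thm)
  moreover have "operator_linear B (\<lambda>x\<in>carrier B. g x + k x)"
    using assms by (auto simp: operator_dual_iff operator_linear_def bounded_operators_add
        scale_operator_add_right Pi_iff)
  ultimately show ?thesis
    by (auto simp: operator_dual_iff dual_add)
qed

lemma dual_smult_closed:
  assumes "g \<in> carrier dual"
  shows "c \<odot>\<^bsub>dual\<^esub> g \<in> carrier dual"
proof -
  obtain K where "\<forall>x\<in>carrier B. norm (g x) \<le> K * norm (F x)"
    using assms by (auto simp: operator_dual_iff)
  then have "\<forall>x\<in>carrier B. norm (scale_operator c (g x)) \<le> (cmod c * K) * norm (F x)"
    by (simp add: norm_scale_operator mult.assoc mult_left_mono)
  moreover have "operator_linear B (\<lambda>x\<in>carrier B. scale_operator c (g x))"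
    using assms by (auto simp: operator_dual_iff operator_linear_def bounded_operators_scale
        scale_operator_add_right scale_operator_scale_operator mult.commute Pi_iff)
  ultimately show ?thesis
    by (auto simp: operator_dual_iff dual_smult)
qed

lemma dual_ext:
  "g \<in> carrier dual \<Longrightarrow> k \<in> carrier dual \<Longrightarrow> (\<And>x. x \<in> carrier B \<Longrightarrow> g x = k x) \<Longrightarrow> g = k"
  by (auto simp: operator_dual_iff intro: extensionalityI)

lemma dual_module: "Module.module complex_ring dual"
proof (rule moduleI)
  show "cring complex_ring"
    by (rule R.is_cring)
  note closed = dual_zero_closed dual_add_closed dual_smult_closed
  show "abelian_group dual"
  proof (rule abelian_groupI)
    fix g assume g: "g \<in> carrier dual"
    show "\<exists>k\<in>carrier dual. k \<oplus>\<^bsub>dual\<^esub> g = \<zero>\<^bsub>dual\<^esub>"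
    proof
      show "(- 1) \<odot>\<^bsub>dual\<^esub> g \<oplus>\<^bsub>dual\<^esub> g = \<zero>\<^bsub>dual\<^esub>"
        using g by (intro dual_ext closed) (auto simp: dual_apply scale_operator_minus_one)
    qed (use g closed in auto)
  qed (auto intro!: dual_ext closed simp: dual_apply add_ac)
qed (auto intro!: dual_ext dual_add_closed dual_smult_closed
      simp: dual_apply scale_operator_add_left scale_operator_add_right
        scale_operator_scale_operator scale_operator_one)

sublocale dual: complex_module dual
  by (rule complex_module.intro) (rule dual_module)

lemma dual_minus_apply:
  assumes "g \<in> carrier dual" "k \<in> carrier dual" "x \<in> carrier B"
  shows "(g \<ominus>\<^bsub>dual\<^esub> k) x = g x - k x"
proof -
  have "g \<ominus>\<^bsub>dual\<^esub> k = g \<oplus>\<^bsub>dual\<^esub> (- 1) \<odot>\<^bsub>dual\<^esub> k"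
    using assms by (simp add: a_minus_def dual.smult_minus_one)
  then show ?thesis
    using assms by (simp add: dual_apply scale_operator_minus_one)
qed

lemma dual_apply_bounded_operators:
  "g \<in> carrier dual \<Longrightarrow> x \<in> carrier B \<Longrightarrow> g x \<in> bounded_operators"
  by (auto simp: operator_dual_iff operator_linear_def)

lemma quadratic_form_add:
  assumes "x \<in> carrier B" "y \<in> carrier B"
  shows "Re (cinner (F (x \<oplus> y) h) h) \<le> Re (cinner (F x h) h) + Re (cinner (F y h) h)"
proof -
  have "F (x \<oplus> y) \<le>\<^sub>L F x + F y"
    using operator_norm assms by (simp add: operator_valued_norm_def)
  then have "Re (cinner (F (x \<oplus> y) h) h) \<le> Re (cinner ((F x + F y) h) h)"
    by (rule operator_le_quadratic_form)
  then show ?thesis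
    by (simp add: blinfun.add_left cinner_add_left)
qed

lemma quadratic_form_smult:
  "x \<in> carrier B \<Longrightarrow> Re (cinner (F (c \<odot> x) h) h) = cmod c * Re (cinner (F x h) h)"
  using operator_norm
  by (simp add: operator_valued_norm_def blinfun.scaleR_left cinner_scaleR_left)

text \<open>
  A positive operator with vanishing quadratic form would be zero.
\<close>

lemma quadratic_form_positive:
  assumes "a \<in> carrier B" "a \<noteq> \<zero>"
  obtains h where "0 < Re (cinner (F a h) h)"
proof -
  have P: "positive_operator (F a)" and "F a \<noteq> 0"
    using F_positive F_zero_iff assms by auto
  then obtain h where "cinner (F a h) h \<noteq> 0"
    using operator_eq_zero_if_quadratic_form_zero[of "F a"] by (auto simp: positive_operator_def)
  moreover have "cinner (F a h) h \<in> \<real>\<^sub>\<ge>\<^sub>0"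
    using P by (simp add: positive_operator_def)
  ultimately have "0 < Re (cinner (F a h) h)"
    by (auto simp: complex_nonneg_Reals_iff complex_eq_iff)
  then show thesis
    by (rule that)
qed

text \<open>
  The seminorm given by the quadratic form of \<open>F\<close> at a vector \<open>h\<close> has a norming functional \<open>f\<close>
  at \<open>a\<close>; after dividing by its value there, \<open>f\<close> times \<open>T\<close> is the desired element of the dual
  space. Its bound is the one for the quadratic form, \<open>(F x h, h) \<le> \<parallel>F x\<parallel> \<parallel>h\<parallel>\<^sup>2\<close>.
\<close>

lemma dual_interpolation:
  assumes a: "a \<in> carrier B" "a \<noteq> \<zero>" and T: "T \<in> bounded_operators"
  obtains \<phi> where "\<phi> \<in> carrier dual" "\<phi> a = T"
proof -
  obtain h where h: "0 < Re (cinner (F a h) h)"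
    using quadratic_form_positive[OF a] by blast
  define p where "p x = Re (cinner (F x h) h)" for x
  obtain f where f_add: "\<And>x y. x \<in> carrier B \<Longrightarrow> y \<in> carrier B \<Longrightarrow> f (x \<oplus> y) = f x + f y"
    and f_scale: "\<And>c x. x \<in> carrier B \<Longrightarrow> f (c \<odot> x) = c * f x"
    and f_le: "\<And>x. x \<in> carrier B \<Longrightarrow> cmod (f x) \<le> p x"
    and f_a: "f a = of_real (p a)"
  proof (rule norming_functional_of_seminorm[of p a])
    show "p (x \<oplus> y) \<le> p x + p y" if "x \<in> carrier B" "y \<in> carrier B" for x y
      using that unfolding p_def by (rule quadratic_form_add)
    show "p (c \<odot> x) = cmod c * p x" if "x \<in> carrier B" for c x
      using that unfolding p_def by (rule quadratic_form_smult)
  qed (use a(1) in auto)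
  define S where "S = (1 / p a) *\<^sub>R T"
  define \<phi> where "\<phi> = (\<lambda>x\<in>carrier B. scale_operator (f x) S)"
  have "S \<in> bounded_operators"
    using T by (simp add: S_def bounded_operators_scaleR)
  then have "operator_linear B \<phi>"
    by (auto simp: \<phi>_def operator_linear_def bounded_operators_scale f_add f_scale
        scale_operator_add_left scale_operator_scale_operator)
  moreover have "norm (\<phi> x) \<le> ((norm h)\<^sup>2 * norm S) * norm (F x)" if x: "x \<in> carrier B" for x
  proof -
    have "cmod (f x) \<le> norm (F x) * (norm h)\<^sup>2"
      using f_le[OF x] quadratic_form_le_norm[of "F x" h] by (simp add: p_def)
    then show ?thesis
      using mult_right_mono[of _ _ "norm S"] x
      by (fastforce simp: \<phi>_def norm_scale_operator mult_ac)
  qed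
  ultimately have "\<phi> \<in> carrier dual"
    by (auto simp: operator_dual_iff \<phi>_def)
  moreover have "\<phi> a = T"
    using a h by (simp add: \<phi>_def f_a S_def scale_operator_of_real p_def)
  ultimately show thesis
    by (rule that)
qed

section \<open>The quotient by the annihilator of a point\<close>

context
  fixes a assumes a: "a \<in> carrier B"
begin

lemma annihilator_submodule: "submodule (annihilator B F a) complex_ring dual"
proof (rule dual.submoduleI)
  fix g assume g: "g \<in> annihilator B F a"
  have "\<ominus>\<^bsub>dual\<^esub> g = (- 1) \<odot>\<^bsub>dual\<^esub> g"
    using g by (simp add: annihilator_def dual.smult_minus_one)
  then show "\<ominus>\<^bsub>dual\<^esub> g \<in> annihilator B F a"
    using g a by (simp add: annihilator_def dual_apply dual_smult_closed
        scale_operator_zero_right)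
qed (use a in \<open>auto simp: annihilator_def dual_apply dual_zero_closed dual_add_closed
    dual_smult_closed scale_operator_zero_right\<close>)

abbreviation coset where "coset \<phi> \<equiv> annihilator B F a +>\<^bsub>dual\<^esub> \<phi>"

abbreviation quotient where "quotient \<equiv> quotient_module dual (annihilator B F a)"

text \<open>
  A class in the quotient consists of all members of the dual space with a prescribed value at
  \<open>a\<close>, which makes the quotient norm independent of the representative.
\<close>

lemma mem_coset_iff:
  "\<phi> \<in> carrier dual \<Longrightarrow> \<psi> \<in> coset \<phi> \<longleftrightarrow> \<psi> \<in> carrier dual \<and> \<psi> a = \<phi> a"
  using dual.coset_mem_iff[OF annihilator_submodule, of \<phi> \<psi>] a
  by (auto simp: annihilator_def dual_minus_apply)

lemma quotient_norm_eq:
  assumes \<phi>: "\<phi> \<in> carrier dual" and \<psi>: "\<psi> \<in> coset \<phi>"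
  shows "quotient_norm F a (coset \<phi>) = norm (\<psi> a) *\<^sub>R F a"
proof -
  have "(SOME \<psi>. \<psi> \<in> coset \<phi>) \<in> coset \<phi>"
    using \<psi> some_in_eq by blast
  then show ?thesis
    using \<phi> \<psi> by (simp add: quotient_norm_def mem_coset_iff)
qed

lemma quotient_norm_coset:
  "\<phi> \<in> carrier dual \<Longrightarrow> quotient_norm F a (coset \<phi>) = norm (\<phi> a) *\<^sub>R F a"
  by (rule quotient_norm_eq) (simp_all add: mem_coset_iff)

lemma quotient_carrier: "carrier quotient = {coset \<phi> |\<phi>. \<phi> \<in> carrier dual}"
  by (rule dual.quotient_module_carrier)

lemma quotient_norm_operator_valued_norm:
  assumes nonzero: "a \<noteq> \<zero>"
  shows "operator_valued_norm quotient (quotient_norm F a)"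
  unfolding operator_valued_norm_def
proof (intro conjI ballI allI funcsetI)
  note N = annihilator_submodule
  have Fa: "positive_operator (F a)" "F a \<noteq> 0"
    using F_positive F_zero_iff a nonzero by auto
  fix C assume "C \<in> carrier quotient"
  then obtain \<phi> where \<phi>: "\<phi> \<in> carrier dual" and C: "C = coset \<phi>"
    by (auto simp: quotient_carrier)
  show "quotient_norm F a C \<in> bounded_operators"
    using Fa(1) \<phi> by (simp add: C quotient_norm_coset bounded_operators_scaleR positive_operator_def)
  show "0 \<le>\<^sub>L quotient_norm F a C"
    using Fa(1) \<phi> by (simp add: C quotient_norm_coset operator_le_def positive_operator_scaleR)
  show "quotient_norm F a (c \<odot>\<^bsub>quotient\<^esub> C) = cmod c *\<^sub>R quotient_norm F a C" for c
  proof -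
    have "c \<odot>\<^bsub>quotient\<^esub> C = coset (c \<odot>\<^bsub>dual\<^esub> \<phi>)"
      using dual.quotient_module_smult[OF N _ \<phi>] by (simp add: C)
    then show ?thesis
      using \<phi> a by (simp add: C quotient_norm_coset dual_smult_closed dual_apply norm_scale_operator)
  qed
  show "quotient_norm F a C = 0 \<longleftrightarrow> C = \<zero>\<^bsub>quotient\<^esub>"
  proof -
    have "\<zero>\<^bsub>quotient\<^esub> = coset \<zero>\<^bsub>dual\<^esub>"
      using dual.submoduleE(1)[OF N] by (simp add: dual.quotient_module_zero)
    then have "C = \<zero>\<^bsub>quotient\<^esub> \<longleftrightarrow> \<phi> \<ominus>\<^bsub>dual\<^esub> \<zero>\<^bsub>dual\<^esub> \<in> annihilator B F a"
      using dual.coset_eq_iff[OF N \<phi> dual_zero_closed] by (simp add: C)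
    also have "\<dots> \<longleftrightarrow> \<phi> a = 0"
      using dual_minus_apply[OF \<phi> dual_zero_closed a] dual.minus_closed[OF \<phi> dual_zero_closed] a
      by (simp add: annihilator_def dual_apply)
    finally show ?thesis
      using \<phi> Fa(2) by (simp add: C quotient_norm_coset)
  qed
  fix D assume "D \<in> carrier quotient"
  then obtain \<psi> where \<psi>: "\<psi> \<in> carrier dual" and D: "D = coset \<psi>"
    by (auto simp: quotient_carrier)
  have "quotient_norm F a (C \<oplus>\<^bsub>quotient\<^esub> D) = norm (\<phi> a + \<psi> a) *\<^sub>R F a"
    using dual.quotient_module_add[OF N \<phi> \<psi>] \<phi> \<psi> a
    by (simp add: C D quotient_norm_coset dual_add_closed dual_apply)
  then have "quotient_norm F a C + quotient_norm F a D - quotient_norm F a (C \<oplus>\<^bsub>quotient\<^esub> D) =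
      (norm (\<phi> a) + norm (\<psi> a) - norm (\<phi> a + \<psi> a)) *\<^sub>R F a"
    using \<phi> \<psi> by (simp add: C D quotient_norm_coset scaleR_left_distrib scaleR_left_diff_distrib)
  moreover have "positive_operator \<dots>"
    using Fa(1) by (rule positive_operator_scaleR) (simp add: norm_triangle_ineq)
  ultimately show "quotient_norm F a (C \<oplus>\<^bsub>quotient\<^esub> D)
      \<le>\<^sub>L quotient_norm F a C + quotient_norm F a D"
    by (simp add: operator_le_def)
qed

text \<open>
  Choosing representatives \<open>\<phi> n\<close> of a Cauchy sequence reduces the claim to the convergence of the
  operators \<open>\<phi> n a\<close>; the limit class is found by interpolating their limit at \<open>a\<close>.
\<close>

lemma quotient_norm_complete:
  assumes nonzero: "a \<noteq> \<zero>"
  shows "operator_complete quotient (quotient_norm F a)"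
  unfolding operator_complete_def
proof (intro allI impI)
  fix Xs assume "\<forall>n. Xs n \<in> carrier quotient" and Cauchy: "operator_Cauchy quotient (quotient_norm F a) Xs"
  then have "\<forall>n. \<exists>\<phi>. \<phi> \<in> carrier dual \<and> Xs n = coset \<phi>"
    unfolding quotient_carrier by blast
  then obtain \<phi> where \<phi>: "\<And>n. \<phi> n \<in> carrier dual" and Xs: "\<And>n. Xs n = coset (\<phi> n)"
    by metis
  have norm_diff: "quotient_norm F a (Xs n \<ominus>\<^bsub>quotient\<^esub> coset \<psi>) = norm (\<phi> n a - \<psi> a) *\<^sub>R F a"
    if "\<psi> \<in> carrier dual" for n \<psi>
    using that \<phi>[of n] a
    by (simp add: Xs dual.quotient_module_minus[OF annihilator_submodule] quotient_norm_coset
        dual_minus_apply)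
  obtain h where h: "0 < Re (cinner (F a h) h)"
    using quadratic_form_positive[OF a nonzero] by blast
  have "h \<noteq> 0"
    using h by (auto simp: cinner_zero_left blinfun.zero_right)
  have "Cauchy (\<lambda>n. \<phi> n a)"
  proof (rule CauchyI)
    fix e :: real assume e: "0 < e"
    \<comment> \<open>Testing the operator inequality at \<open>h\<close> bounds the norm of the difference by
      \<open>d \<parallel>h\<parallel>\<^sup>2 / (F a h, h)\<close>, which this \<open>d\<close> makes equal to \<open>e / 2\<close>.\<close>
    define d where "d = e * Re (cinner (F a h) h) / (2 * (norm h)\<^sup>2)"
    have "0 < d"
      using e h \<open>h \<noteq> 0\<close> by (simp add: d_def)
    then obtain N where N: "\<And>n m. N \<le> n \<Longrightarrow> N \<le> m \<Longrightarrow>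
        quotient_norm F a (Xs n \<ominus>\<^bsub>quotient\<^esub> Xs m) \<le>\<^sub>L d *\<^sub>R id_blinfun"
      using Cauchy unfolding operator_Cauchy_def by blast
    have "norm (\<phi> n a - \<phi> m a) < e" if "N \<le> n" "N \<le> m" for n m
    proof -
      have "norm (\<phi> n a - \<phi> m a) * Re (cinner (F a h) h) \<le> d * (norm h)\<^sup>2"
        using operator_le_quadratic_form[OF N[OF that], of h]
        by (simp add: Xs[of m] norm_diff[OF \<phi>] blinfun.scaleR_left cinner_scaleR_left Re_cinner_self)
      also have "\<dots> = e / 2 * Re (cinner (F a h) h)"
        using \<open>h \<noteq> 0\<close> by (simp add: d_def)
      finally show ?thesis
        using h e by (simp add: field_simps)
    qed
    then show "\<exists>N. \<forall>m\<ge>N. \<forall>n\<ge>N. norm (\<phi> m a - \<phi> n a) < e"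
      by blast
  qed
  then obtain T where T: "(\<lambda>n. \<phi> n a) \<longlonglongrightarrow> T"
    using Cauchy_convergent convergent_def by blast
  have "T \<in> bounded_operators"
    using closed_sequentially[OF closed_bounded_operators _ T]
      dual_apply_bounded_operators[OF \<phi> a] by blast
  then obtain \<psi> where \<psi>: "\<psi> \<in> carrier dual" "\<psi> a = T"
    using dual_interpolation[OF a nonzero] by blast
  have "operator_converges quotient (quotient_norm F a) Xs (coset \<psi>)"
    unfolding operator_converges_def
  proof (intro allI impI)
    fix e :: real assume e: "0 < e"
    have "0 < norm (F a)"
      using F_zero_iff a nonzero by simp
    then have "0 < e / norm (F a)"
      using e by simp
    then obtain N where N: "\<And>n. N \<le> n \<Longrightarrow> norm (\<phi> n a - T) < e / norm (F a)"
      using LIMSEQ_D[OF T] by blast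
    have "quotient_norm F a (Xs n \<ominus>\<^bsub>quotient\<^esub> coset \<psi>) \<le>\<^sub>L e *\<^sub>R id_blinfun" if "N \<le> n" for n
      unfolding norm_diff[OF \<psi>(1)] \<psi>(2)
    proof (rule positive_operator_le_scaleR_id)
      show "positive_operator (norm (\<phi> n a - T) *\<^sub>R F a)"
        using F_positive[OF a] by (rule positive_operator_scaleR) simp
      show "norm (norm (\<phi> n a - T) *\<^sub>R F a) \<le> e"
        using N[OF that] \<open>0 < norm (F a)\<close> by (simp add: field_simps)
    qed
    then show "\<exists>N. \<forall>n\<ge>N. quotient_norm F a (Xs n \<ominus>\<^bsub>quotient\<^esub> coset \<psi>) \<le>\<^sub>L e *\<^sub>R id_blinfun"
      by blast
  qed
  moreover have "coset \<psi> \<in> carrier quotient"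
    using \<psi>(1) unfolding quotient_carrier by blast
  ultimately show "\<exists>l\<in>carrier quotient. operator_converges quotient (quotient_norm F a) Xs l"
    by blast
qed

end

end

theorem theorem2p10:
  fixes B :: "(complex, 'b) module"
    and F :: "'b \<Rightarrow> ('h :: complex_hilbert \<Rightarrow>\<^sub>L 'h)"
    and a :: 'b
  assumes "\<exists>h :: 'h. h \<noteq> 0"
    and "carrier B \<noteq> {\<zero>\<^bsub>B\<^esub>}"
    and "banach_space_wrt B F"
    and "a \<in> carrier B - {\<zero>\<^bsub>B\<^esub>}"
  shows "(\<forall>C \<in> carrier (quotient_module (operator_dual B F) (annihilator B F a)).
            \<forall>\<phi>\<in>C. quotient_norm F a C = norm (\<phi> a) *\<^sub>R F a) \<and>
         banach_space_wrt (quotient_module (operator_dual B F) (annihilator B F a))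
           (quotient_norm F a)"
proof -
  interpret operator_normed_space B F
    using assms(3) by (simp add: operator_normed_space_def operator_normed_space_axioms_def
        complex_module_def banach_space_wrt_def complex_linear_space_def)
  have a: "a \<in> carrier B" "a \<noteq> \<zero>\<^bsub>B\<^esub>"
    using assms(4) by auto
  show ?thesis
    using quotient_norm_eq[OF a(1)] quotient_norm_operator_valued_norm[OF a]
      quotient_norm_complete[OF a] dual.quotient_module_module[OF annihilator_submodule[OF a(1)]]
    by (auto simp: quotient_carrier[OF a(1)] banach_space_wrt_def complex_linear_space_def)
qed

end
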